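(* Let $T$ be a tree. Then $$H_e(T,x) = \frac{1}{x}H(T,x) - \frac{|V(T)|}{x},$$ equivalently $H(T,x) = xH_e(T,x) + |V(T)|$, where $H(T,x)$ is the Hosoya polynomial and $H_e(T,x)$ the edge-Hosoya polynomial of $T$.
   Context: For a connected graph $G$ and $k\ge 0$, $d(G,k)$ is the number of unordered pairs of vertices of $G$ at distance $k$ (for $k=0$ this counts each vertex paired with itself, so $d(G,0)=|V(G)|$), and the Hosoya polynomial is $H(G,x)=\sum_{k\ge0} d(G,k)x^k$. The distance $d(e,f)$ between edges $e,f$ is their distance as vertices of the line graph $L(G)$; $d_e(G,k)$ is the number of unordered pairs of edges at distance $k$ (with $d_e(G,0)=|E(G)|$), and the edge-Hosoya polynomial is $H_e(G,x)=\sum_{k\ge0} d_e(G,k)x^k$, i.e. $H_e(G,x)=H(L(G),x)$. *)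

theory Defs
  imports
    "HOL-Computational_Algebra.Polynomial"
    "HOL-Computational_Algebra.Polynomial_Factorial"
    "HOL-Library.Extended_Nat"
begin

record 'a sgraph =
  verts :: "'a set"
  edges :: "'a set set"

definition simple_graph :: "'a sgraph \<Rightarrow> bool" where
  "simple_graph G \<longleftrightarrow>
     finite (verts G) \<and> (\<forall>e\<in>edges G. e \<subseteq> verts G \<and> card e = 2)"

definition is_path :: "'a sgraph \<Rightarrow> 'a list \<Rightarrow> bool" where
  "is_path G p \<longleftrightarrow>
     p \<noteq> [] \<and> distinct p \<and> set p \<subseteq> verts G \<and> successively (\<lambda>u v. {u, v} \<in> edges G) p"

definition path_between :: "'a sgraph \<Rightarrow> 'a \<Rightarrow> 'a list \<Rightarrow> 'a \<Rightarrow> bool" where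
  "path_between G u p v \<longleftrightarrow> is_path G p \<and> hd p = u \<and> last p = v"

(* A cycle of length n is given by its n distinct vertices; the starting vertex is not repeated. *)
definition is_cycle :: "'a sgraph \<Rightarrow> 'a list \<Rightarrow> bool" where
  "is_cycle G c \<longleftrightarrow> is_path G c \<and> length c \<ge> 3 \<and> {last c, hd c} \<in> edges G"

definition connected_graph :: "'a sgraph \<Rightarrow> bool" where
  "connected_graph G \<longleftrightarrow>
     verts G \<noteq> {} \<and> (\<forall>u\<in>verts G. \<forall>v\<in>verts G. \<exists>p. path_between G u p v)"

definition is_tree :: "'a sgraph \<Rightarrow> bool" where
  "is_tree G \<longleftrightarrow> simple_graph G \<and> connected_graph G \<and> (\<nexists>c. is_cycle G c)"

(* The length of a path is its number of edges; vertices not joined by a path have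
   distance infinity, as the infimum of the empty set. *)
definition graph_dist :: "'a sgraph \<Rightarrow> 'a \<Rightarrow> 'a \<Rightarrow> enat" where
  "graph_dist G u v = (INF p\<in>{p. path_between G u p v}. enat (length p - 1))"

definition line_graph :: "'a sgraph \<Rightarrow> 'a set sgraph" where
  "line_graph G =
     \<lparr>verts = edges G,
      edges = {{e, f} | e f. e \<in> edges G \<and> f \<in> edges G \<and> e \<noteq> f \<and> e \<inter> f \<noteq> {}}\<rparr>"

definition edge_dist :: "'a sgraph \<Rightarrow> 'a set \<Rightarrow> 'a set \<Rightarrow> enat" where
  "edge_dist G e f = graph_dist (line_graph G) e f"

(* Unordered pairs are the sets {u, v}, with u = v allowed. *)
definition num_dist :: "'a sgraph \<Rightarrow> nat \<Rightarrow> nat" where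
  "num_dist G k = card {{u, v} | u v. u \<in> verts G \<and> v \<in> verts G \<and> graph_dist G u v = enat k}"

definition num_edge_dist :: "'a sgraph \<Rightarrow> nat \<Rightarrow> nat" where
  "num_edge_dist G k = card {{e, f} | e f. e \<in> edges G \<and> f \<in> edges G \<and> edge_dist G e f = enat k}"

(* The sums range over all k with a nonzero coefficient; in a finite graph there are only
   finitely many of them. *)
definition hosoya :: "'a sgraph \<Rightarrow> int poly" where
  "hosoya G = (\<Sum>k | num_dist G k \<noteq> 0. monom (int (num_dist G k)) k)"

definition edge_hosoya :: "'a sgraph \<Rightarrow> int poly" where
  "edge_hosoya G = (\<Sum>k | num_edge_dist G k \<noteq> 0. monom (int (num_edge_dist G k)) k)"

lemma num_edge_dist_line_graph: "num_edge_dist G k = num_dist (line_graph G) k"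
  by (simp add: num_edge_dist_def num_dist_def edge_dist_def line_graph_def)

lemma edge_hosoya_line_graph: "edge_hosoya G = hosoya (line_graph G)"
  by (simp add: edge_hosoya_def hosoya_def num_edge_dist_line_graph)

lemma finite_num_dist_support:
  assumes "finite (verts G)"
  shows "finite {k. num_dist G k \<noteq> 0}"
proof (rule finite_subset)
  show "{k. num_dist G k \<noteq> 0} \<subseteq>
          (\<lambda>(u, v). the_enat (graph_dist G u v)) ` (verts G \<times> verts G)"
  proof
    fix k assume "k \<in> {k. num_dist G k \<noteq> 0}"
    then have "{{u, v} | u v. u \<in> verts G \<and> v \<in> verts G \<and> graph_dist G u v = enat k} \<noteq> {}"
      unfolding num_dist_def by (intro notI) (simp only: mem_Collect_eq card.empty)
    then obtain u v where "u \<in> verts G" "v \<in> verts G" "graph_dist G u v = enat k"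
      by blast
    then show "k \<in> (\<lambda>(u, v). the_enat (graph_dist G u v)) ` (verts G \<times> verts G)"
      by (intro image_eqI[of _ _ "(u, v)"]) auto
  qed
  show "finite ((\<lambda>(u, v). the_enat (graph_dist G u v)) ` (verts G \<times> verts G))"
    using assms by simp
qed

lemma coeff_hosoya:
  assumes "finite (verts G)"
  shows "coeff (hosoya G) k = int (num_dist G k)"
proof -
  have "coeff (hosoya G) k =
      (\<Sum>i | num_dist G i \<noteq> 0. if i = k then int (num_dist G i) else 0)"
    unfolding hosoya_def coeff_sum coeff_monom ..
  also have "\<dots> = int (num_dist G k)"
    using sum.delta'[OF finite_num_dist_support[OF assms], of k "\<lambda>i. int (num_dist G i)"]
    by (auto simp: eq_commute[of k])
  finally show ?thesis .
qed

lemma graph_dist_eq_0_iff: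
  assumes "u \<in> verts G"
  shows "graph_dist G u v = 0 \<longleftrightarrow> u = v"
proof
  assume "u = v"
  then have "path_between G u [u] v"
    using assms by (simp add: path_between_def is_path_def)
  then have "graph_dist G u v \<le> enat (length [u] - 1)"
    unfolding graph_dist_def by (intro INF_lower) simp
  then show "graph_dist G u v = 0"
    by (simp add: zero_enat_def[symmetric])
next
  let ?S = "(\<lambda>p. enat (length p - 1)) ` {p. path_between G u p v}"
  assume 0: "graph_dist G u v = 0"
  then have "?S \<noteq> {}"
    unfolding graph_dist_def by (metis Inf_enat_def i0_ne_infinity)
  then have "Inf ?S \<in> ?S"
    unfolding Inf_enat_def by (metis LeastI equals0I)
  then obtain p where "path_between G u p v" "length p - 1 = 0"
    using 0 unfolding graph_dist_def by (auto simp: zero_enat_def)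
  then show "u = v"
    by (cases p) (auto simp: path_between_def is_path_def)
qed

lemma num_dist_0: "num_dist G 0 = card (verts G)"
proof -
  have "{{u, v} | u v. u \<in> verts G \<and> v \<in> verts G \<and> graph_dist G u v = enat 0}
      = (\<lambda>v. {v}) ` verts G"
    by (auto simp: graph_dist_eq_0_iff zero_enat_def[symmetric])
  then show ?thesis
    by (simp add: num_dist_def card_image)
qed

end

theory Submission
  imports Defs
begin

text \<open>
  In a tree any two vertices are joined by exactly one path, and a path with at least one edge
  is determined, up to reversal, by its pair of ends and likewise by its pair of extremal edges.
  Every pair of edges consists of the extremal edges of some path, and a path with \<open>k + 1\<close> edges
  has ends at distance \<open>k + 1\<close> and extremal edges at distance \<open>k\<close>. Hence there are as many pairs of
  vertices at distance \<open>k + 1\<close> as pairs of edges at distance \<open>k\<close>.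
\<close>

section \<open>Extremal edges of a path, and counting two images of one set\<close>

text \<open>Meaningful only for lists with at least two vertices. The last edge of \<open>p\<close>
  is obtained as \<open>first_edge (rev p)\<close>.\<close>

definition first_edge :: "'a list \<Rightarrow> 'a set" where
  "first_edge p = {hd p, hd (tl p)}"

text \<open>A set rather than a pair, so that a path and its reversal get the same value. For a path
  with a single edge it is a singleton, in accordance with the pairs \<open>{e, e}\<close> counted
  by \<open>num_edge_dist\<close>.\<close>

definition end_edges :: "'a list \<Rightarrow> 'a set set" where
  "end_edges p = {first_edge p, first_edge (rev p)}"

text \<open>Both images are in bijection with the quotient of \<open>S\<close> by the common kernel.
  The map \<open>h\<close> sends a value of \<open>f\<close> to the value of \<open>g\<close> at any
  preimage; the choice of the preimage does not matter.\<close>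

lemma card_image_eq_of_same_kernel:
  assumes "\<And>x y. x \<in> S \<Longrightarrow> y \<in> S \<Longrightarrow> f x = f y \<longleftrightarrow> g x = g y"
  shows "card (f ` S) = card (g ` S)"
proof -
  define h where "h z = g (inv_into S f z)" for z
  have h: "h (f x) = g x" if "x \<in> S" for x
    using assms[of "inv_into S f (f x)" x] that
    by (simp add: h_def f_inv_into_f inv_into_into)
  have "bij_betw h (f ` S) (g ` S)"
    unfolding bij_betw_def
  proof
    show "inj_on h (f ` S)"
      by (auto simp: inj_on_def h assms)
    show "h ` f ` S = g ` S"
      by (force simp: h)
  qed
  then show ?thesis
    by (rule bij_betw_same_card)
qed

section \<open>Operations on paths\<close>

lemma is_path_rev: "is_path G (rev p) \<longleftrightarrow> is_path G p"
  by (simp add: is_path_def insert_commute)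

lemma is_path_appendD1: "is_path G (p @ q) \<Longrightarrow> p \<noteq> [] \<Longrightarrow> is_path G p"
  by (auto simp: is_path_def successively_append_iff)

lemma is_path_appendD2: "is_path G (p @ q) \<Longrightarrow> q \<noteq> [] \<Longrightarrow> is_path G q"
  by (auto simp: is_path_def successively_append_iff)

lemma is_path_Cons:
  assumes "p \<noteq> []"
  shows "is_path G (x # p) \<longleftrightarrow>
    x \<in> verts G \<and> x \<notin> set p \<and> {x, hd p} \<in> edges G \<and> is_path G p"
  using assms by (cases p) (auto simp: is_path_def)

text \<open>The two paths are glued at their common vertex \<open>z\<close>, which each of them
  already keeps apart from its own other vertices; only \<open>p\<close> and \<open>q\<close> remain
  to be compared.\<close>

lemma is_path_append:
  assumes "is_path G (p @ [z])" "is_path G (z # q)" "set p \<inter> set q = {}"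
  shows "is_path G (p @ z # q)"
  using assms by (cases q) (auto simp: is_path_def successively_append_iff)

section \<open>Paths in trees and their uniqueness\<close>

lemma tree_edge:
  assumes "is_tree T" "{x, y} \<in> edges T"
  shows "x \<in> verts T" "y \<in> verts T" "x \<noteq> y"
proof -
  have "{x, y} \<subseteq> verts T \<and> card {x, y} = 2"
    using assms unfolding is_tree_def simple_graph_def by blast
  then show "x \<in> verts T" "y \<in> verts T" "x \<noteq> y"
    by auto
qed

lemma tree_edge_doubleton:
  assumes "is_tree T" "e \<in> edges T"
  obtains x y where "e = {x, y}" "x \<noteq> y" "x \<in> verts T" "y \<in> verts T"
proof -
  have "e \<subseteq> verts T \<and> card e = 2"
    using assms unfolding is_tree_def simple_graph_def by blast
  then show ?thesis
    using that by (auto simp: card_2_iff)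
qed

lemma tree_path_exists:
  assumes "is_tree T" "u \<in> verts T" "v \<in> verts T"
  obtains p where "path_between T u p v"
  using assms unfolding is_tree_def connected_graph_def by blast

text \<open>A step from the start of a path either leaves the path or runs along its first edge. If
  it reached a later vertex of the path, the segment up to that vertex would close to a
  cycle.\<close>

lemma tree_path_extend:
  assumes T: "is_tree T" and p: "is_path T p" and e: "{hd p, b} \<in> edges T"
  shows "is_path T (b # p) \<or> (\<exists>r. p = hd p # b # r)"
proof (cases "b \<in> set p")
  case False
  then show ?thesis
    using p e tree_edge[OF T e] is_path_Cons[of p T b] by (auto simp: is_path_def insert_commute)
next
  case True
  then obtain q r where qr: "p = q @ b # r"
    by (auto simp: in_set_conv_decomp)
  then have q: "q \<noteq> []"
    using tree_edge(3)[OF T e] by (cases q) auto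
  have "is_path T (q @ [b])"
    using p qr is_path_appendD1[of T "q @ [b]" r] by simp
  moreover have "\<not> is_cycle T (q @ [b])"
    using T by (auto simp: is_tree_def)
  ultimately have "length q < 2"
    using e q qr by (auto simp: is_cycle_def insert_commute)
  with q obtain a where "q = [a]"
    by (cases q) auto
  with qr show ?thesis
    by simp
qed

text \<open>Induction along the first path. If both paths take the same first step, the start is
  removed; if they part, following one until it meets the other and returning along the latter gives
  a cycle through \<open>u\<close>.\<close>

lemma tree_path_unique:
  assumes T: "is_tree T"
  shows "path_between T u p v \<Longrightarrow> path_between T u q v \<Longrightarrow> p = q"
proof (induction p arbitrary: u q)
  case Nil
  then show ?case
    by (simp add: path_between_def is_path_def)
next
  case (Cons a p)
  then have a: "a = u"
    by (simp add: path_between_def)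
  obtain q' where q: "q = u # q'"
    using Cons.prems(2) by (cases q) (auto simp: path_between_def is_path_def)
  show ?case
  proof (cases "u = v")
    case True
    then show ?thesis
      using Cons.prems a q
      by (cases "p = []"; cases "q' = []") (auto simp: path_between_def is_path_def)
  next
    case False
    then have ne: "p \<noteq> []" "q' \<noteq> []"
      using Cons.prems a q by (auto simp: path_between_def)
    then have p': "is_path T p" "last p = v" "u \<notin> set p" "{u, hd p} \<in> edges T"
      and q': "is_path T q'" "last q' = v" "u \<notin> set q'" "{u, hd q'} \<in> edges T"
      and u: "u \<in> verts T"
      using Cons.prems a q by (auto simp: path_between_def is_path_Cons)
    show ?thesis
    proof (cases "hd p = hd q'")
      case True
      then have "p = q'"
        using p' q' by (intro Cons.IH[of "hd p"]) (auto simp: path_between_def)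
      then show ?thesis
        using a q by simp
    next
      case neq: False
      \<comment> \<open>Both tails end in \<open>v\<close>, so they meet.\<close>
      have "\<exists>x\<in>set p. x \<in> set q'"
        using p' q' ne by (metis last_in_set)
      \<comment> \<open>Taking the first meeting point \<open>z\<close> makes \<open>p1\<close>
        disjoint from all of \<open>q'\<close>.\<close>
      then obtain p1 z p2 where z: "p = p1 @ z # p2" "z \<in> set q'" "\<forall>x\<in>set p1. x \<notin> set q'"
        using split_list_first_prop[of p "\<lambda>x. x \<in> set q'"] by auto
      then obtain q1 q2 where q1: "q' = q1 @ z # q2"
        by (auto simp: in_set_conv_decomp)
      have "is_path T (u # p1 @ [z])"
        using p' u z is_path_appendD1[of T "p1 @ [z]" p2] by (auto simp: is_path_Cons hd_append)
      moreover have "is_path T (z # rev q1)"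
        using q' q1 is_path_appendD1[of T "q1 @ [z]" q2] is_path_rev[of T "q1 @ [z]"] by simp
      moreover have "set (u # p1) \<inter> set (rev q1) = {}"
        using z q1 q' by auto
      ultimately have "is_path T (u # p1 @ z # rev q1)"
        using is_path_append[of T "u # p1" z "rev q1"] by simp
      moreover have "last (u # p1 @ z # rev q1) = hd q'"
        using q1 by (cases q1) auto
      \<comment> \<open>If both were empty, the two first steps would lead to the same vertex
        \<open>z\<close>. Hence the closed walk has at least three vertices.\<close>
      moreover have "p1 \<noteq> [] \<or> q1 \<noteq> []"
        using neq z q1 by auto
      then have "3 \<le> length (u # p1 @ z # rev q1)"
        by (cases p1; cases q1) auto
      ultimately have "is_cycle T (u # p1 @ z # rev q1)"
        using q' by (auto simp: is_cycle_def insert_commute)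
      then show ?thesis
        using T by (auto simp: is_tree_def)
    qed
  qed
qed

lemma tree_path_eqI:
  assumes "is_tree T" "is_path T p" "is_path T q" "hd p = hd q" "last p = last q"
  shows "p = q"
  using tree_path_unique[OF assms(1)] assms by (simp add: path_between_def)

lemma tree_graph_dist:
  assumes "is_tree T" "path_between T u p v"
  shows "graph_dist T u v = enat (length p - 1)"
proof -
  have "{q. path_between T u q v} = {p}"
    using assms tree_path_unique by fast
  then show ?thesis
    by (simp add: graph_dist_def)
qed

section \<open>Distance between the extremal edges of a path\<close>

text \<open>Consecutive edges of \<open>g\<close> share a vertex, so each edge of \<open>g\<close>
  contributes at most one step towards \<open>y\<close>. The ends \<open>x\<close> and
  \<open>y\<close> are arbitrary vertices of the two outer edges, which lets the induction restart
  at a shared vertex. The lemma supplies the lower bound for the edge distance.\<close>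

lemma tree_path_length_le_line_path:
  assumes T: "is_tree T"
  shows "is_path (line_graph T) g \<Longrightarrow> x \<in> hd g \<Longrightarrow> y \<in> last g \<Longrightarrow> path_between T x p y
    \<Longrightarrow> length p \<le> length g + 1"
proof (induction g arbitrary: x p)
  case Nil
  then show ?case
    by (simp add: is_path_def)
next
  case (Cons e g)
  have e: "e \<in> edges T"
    using Cons.prems(1) by (auto simp: is_path_def line_graph_def)
  have adj: "{s, t} \<in> edges T" if "s \<in> e" "t \<in> e" "s \<noteq> t" for s t
    using tree_edge_doubleton[OF T e] e that
    by (metis insert_commute insert_iff singletonD)
  have xv: "x \<in> verts T"
    using Cons.prems(4) by (cases p) (auto simp: path_between_def is_path_def)
  have xx: "path_between T x [x] x"
    using xv by (simp add: path_between_def is_path_def)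
  show ?case
  proof (cases "g = []")
    case True
    show ?thesis
    proof (cases "x = y")
      case True
      then have "p = [x]"
        using tree_path_unique[OF T Cons.prems(4)] xx by simp
      then show ?thesis
        by simp
    next
      case False
      then have "{x, y} \<in> edges T"
        using adj Cons.prems \<open>g = []\<close> by simp
      then have "path_between T x [x, y] y"
        using tree_edge[OF T] by (auto simp: path_between_def is_path_def)
      then have "p = [x, y]"
        using tree_path_unique[OF T Cons.prems(4)] by simp
      then show ?thesis
        by simp
    qed
  next
    case g: False
    then have g': "is_path (line_graph T) g" "{e, hd g} \<in> edges (line_graph T)"
      using Cons.prems(1) by (auto simp: is_path_Cons)
    then obtain z where z: "z \<in> e" "z \<in> hd g"
      by (auto simp: line_graph_def doubleton_eq_iff)
    have "z \<in> verts T" "y \<in> verts T"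
    proof -
      show "z \<in> verts T"
        using z e T by (auto simp: is_tree_def simple_graph_def)
      show "y \<in> verts T"
        using Cons.prems(4) by (cases p rule: rev_cases) (auto simp: path_between_def is_path_def)
    qed
    then obtain q where q: "path_between T z q y"
      using tree_path_exists[OF T] by blast
    have IH: "length q \<le> length g + 1"
      using Cons.IH[OF g'(1) z(2) _ q] Cons.prems(3) g by simp
    show ?thesis
    proof (cases "x = z")
      case True
      then show ?thesis
        using tree_path_unique[OF T Cons.prems(4)] q IH by simp
    next
      case False
      have "{hd q, x} \<in> edges T"
        using adj[of z x] z(1) Cons.prems(2) False q by (auto simp: path_between_def)
      \<comment> \<open>Moving the start from \<open>z\<close> to its neighbour \<open>x\<close>
        either lengthens the path to \<open>y\<close> by one edge or removes its first edge.\<close>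
      then consider "is_path T (x # q)" | r where "q = z # x # r"
        using tree_path_extend[OF T, of q x] q by (auto simp: path_between_def)
      then show ?thesis
      proof cases
        case 1
        then have "path_between T x (x # q) y"
          using q by (auto simp: path_between_def is_path_def)
        then have "p = x # q"
          using tree_path_unique[OF T Cons.prems(4)] by simp
        then show ?thesis
          using IH by simp
      next
        case 2
        then have "path_between T x (x # r) y"
          using q by (auto simp: path_between_def is_path_Cons)
        then have "p = x # r"
          using tree_path_unique[OF T Cons.prems(4)] by simp
        then show ?thesis
          using IH 2 by simp
      qed
    qed
  qed
qed

lemma first_edge_rev:
  assumes "2 \<le> length p"
  shows "first_edge (rev p) = {p ! (length p - 2), p ! (length p - 1)}"
  using assms by (cases p rule: rev_cases; cases "butlast p" rule: rev_cases)
    (auto simp: first_edge_def nth_append insert_commute)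

lemma first_edge_nth: "2 \<le> length p \<Longrightarrow> first_edge p = {p ! 0, p ! 1}"
  by (cases p; cases "tl p") (auto simp: first_edge_def)

text \<open>The successive edges of a path form a path in the line graph: \<open>k + 2\<close>
  vertices give \<open>k + 1\<close> edges, hence a path of length \<open>k\<close> there.\<close>

lemma line_graph_path_of_path:
  assumes p: "is_path G p" and len: "length p = k + 2"
  shows "path_between (line_graph G) (first_edge p)
    (map (\<lambda>i. {p ! i, p ! Suc i}) [0..<Suc k]) (first_edge (rev p))"
proof -
  let ?e = "\<lambda>i. {p ! i, p ! Suc i}"
  have edge: "?e i \<in> edges G" if "i < Suc k" for i
    using p that len by (auto simp: is_path_def successively_conv_nth)
  \<comment> \<open>The crossed match of the end vertices would force both \<open>i = Suc j\<close>
    and \<open>Suc i = j\<close>.\<close>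
  have inj: "i = j" if "?e i = ?e j" "i < Suc k" "j < Suc k" for i j
    using that p len by (auto simp: is_path_def doubleton_eq_iff nth_eq_iff_index_eq)
  have "{?e i, ?e (Suc i)} \<in> edges (line_graph G)" if "Suc i < Suc k" for i
  proof -
    have "?e i \<noteq> ?e (Suc i)"
      using inj[of i "Suc i"] that by auto
    moreover have "?e i \<inter> ?e (Suc i) \<noteq> {}"
      by blast
    ultimately show ?thesis
      using edge[of i] edge[of "Suc i"] that unfolding line_graph_def by simp blast
  qed
  then have "successively (\<lambda>u v. {u, v} \<in> edges (line_graph G)) (map ?e [0..<Suc k])"
    by (simp add: successively_conv_nth del: upt_Suc)
  moreover have "distinct (map ?e [0..<Suc k])"
    using inj by (auto simp: distinct_map inj_on_def simp del: upt_Suc)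
  moreover have "set (map ?e [0..<Suc k]) \<subseteq> verts (line_graph G)"
    using edge by (auto simp: line_graph_def simp del: upt_Suc)
  moreover have "hd (map ?e [0..<Suc k]) = first_edge p"
    using len by (simp add: hd_map first_edge_nth del: upt_Suc)
  moreover have "last (map ?e [0..<Suc k]) = first_edge (rev p)"
    using len by (simp add: first_edge_rev)
  ultimately show ?thesis
    by (simp add: path_between_def is_path_def del: upt_Suc)
qed

text \<open>The list of edges of \<open>p\<close> gives the upper bound. For the lower bound, any
  path \<open>g\<close> of the line graph between the two edges is compared with \<open>p\<close>
  itself, the path joining the outer vertices of these edges.\<close>

lemma tree_edge_dist:
  assumes T: "is_tree T" and p: "is_path T p" and len: "length p = k + 2"
  shows "edge_dist T (first_edge p) (first_edge (rev p)) = enat k"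
proof (rule antisym)
  show "edge_dist T (first_edge p) (first_edge (rev p)) \<le> enat k"
    unfolding edge_dist_def graph_dist_def
    by (rule INF_lower2[of "map (\<lambda>i. {p ! i, p ! Suc i}) [0..<Suc k]"])
      (use line_graph_path_of_path[OF p len] in \<open>simp_all del: upt_Suc\<close>)
  show "enat k \<le> edge_dist T (first_edge p) (first_edge (rev p))"
    unfolding edge_dist_def graph_dist_def
  proof (rule INF_greatest)
    fix g assume "g \<in> {g. path_between (line_graph T) (first_edge p) g (first_edge (rev p))}"
    then have g: "is_path (line_graph T) g" "hd g = first_edge p" "last g = first_edge (rev p)"
      by (auto simp: path_between_def)
    have "path_between T (hd p) p (last p)"
      using p by (simp add: path_between_def)
    moreover have "last p \<in> first_edge (rev p)" "hd p \<in> first_edge p"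
      using len by (auto simp: first_edge_def hd_rev)
    ultimately have "length p \<le> length g + 1"
      using tree_path_length_le_line_path[OF T g(1)] g by metis
    then show "enat k \<le> enat (length g - 1)"
      using len by simp
  qed
qed

section \<open>Correspondence between pairs of edges and paths\<close>

text \<open>A path from a vertex of \<open>e\<close> to a vertex of \<open>f\<close> is extended at
  each end, unless it already runs through the edge there. The case \<open>e = f\<close> is
  included.\<close>

lemma tree_path_through_edges:
  assumes T: "is_tree T" and e: "e \<in> edges T" and f: "f \<in> edges T"
  obtains p where "is_path T p" "2 \<le> length p" "first_edge p = e" "first_edge (rev p) = f"
proof -
  obtain a b where ab: "e = {a, b}" "a \<in> verts T"
    using tree_edge_doubleton[OF T e] by metis
  obtain c d where cd: "f = {c, d}" "c \<in> verts T"
    using tree_edge_doubleton[OF T f] by metis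
  obtain r where r: "is_path T r" "hd r = a" "last r = c"
    using tree_path_exists[OF T ab(2) cd(2)] unfolding path_between_def by blast
  \<comment> \<open>Having two vertices in \<open>q\<close> ensures that a later extension at the
    other end leaves the first edge unchanged.\<close>
  obtain q where q: "is_path T q" "2 \<le> length q" "first_edge q = e" "last q = c"
  proof -
    have "r \<noteq> []"
      using r by (simp add: is_path_def)
    then show ?thesis
      using tree_path_extend[OF T r(1), of b] r ab e that[of "b # r"] that[of r]
      by (cases r) (auto simp: first_edge_def insert_commute)
  qed
  have "q \<noteq> []"
    using q by auto
  then have hd: "hd (rev q) = c"
    using q by (simp add: hd_rev)
  consider "is_path T (d # rev q)" | s where "rev q = c # d # s"
    using tree_path_extend[OF T, of "rev q" d] q cd f hd by (auto simp: is_path_rev)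
  then show thesis
  proof cases
    case 1
    then have "is_path T (q @ [d])"
      using is_path_rev[of T "q @ [d]"] by simp
    moreover have "first_edge (q @ [d]) = e"
      using q by (cases q; cases "tl q") (auto simp: first_edge_def)
    moreover have "first_edge (rev (q @ [d])) = f"
      using hd cd by (auto simp: first_edge_def)
    ultimately show ?thesis
      using that[of "q @ [d]"] q by simp
  next
    case 2
    then have "first_edge (rev q) = f"
      using cd by (simp add: first_edge_def)
    then show ?thesis
      using that q by simp
  qed
qed

text \<open>If \<open>p\<close> and \<open>q\<close> traverse a shared extremal edge in opposite
  directions, dropping the outer vertex of \<open>p\<close> there gives a path that ends where
  \<open>q\<close> does. With every mismatch removed, uniqueness would make a proper part of
  \<open>p\<close> equal to \<open>q\<close>, against the equal lengths.\<close>

lemma tree_path_ends_eq_of_edges_eq: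
  assumes T: "is_tree T" and p: "is_path T p" "2 \<le> length p"
    and q: "is_path T q" "length q = length p"
    and e: "first_edge p = first_edge q" and f: "first_edge (rev p) = first_edge (rev q)"
  shows "{hd p, last p} = {hd q, last q}"
proof -
  show ?thesis
  \<comment> \<open>For a single edge opposite directions do occur, and removing both ends would
    leave no path; the unordered pair of ends is still the same.\<close>
  proof (cases "length p = 2")
    case True
    then obtain a b a' b' where "p = [a, b]" "q = [a', b']"
      using q(2) by (auto simp: numeral_2_eq_2 length_Suc_conv)
    then show ?thesis
      using e by (simp add: first_edge_def)
  next
    case False
    with p(2) q(2) have len: "3 \<le> length p" "3 \<le> length q"
      by auto
    have hds: "hd p = hd q \<or> hd p = hd (tl q) \<and> hd (tl p) = hd q"
      using e by (auto simp: first_edge_def doubleton_eq_iff)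
    have lasts: "last p = last q \<or> last p = last (butlast q) \<and> last (butlast p) = last q"
    proof -
      have "first_edge (rev r) = {last r, last (butlast r)}" if "3 \<le> length r" for r :: "'a list"
        using that by (cases r rule: rev_cases) (simp_all add: first_edge_def hd_rev)
      then have "{last p, last (butlast p)} = {last q, last (butlast q)}"
        using f len by metis
      then show ?thesis
        unfolding doubleton_eq_iff by blast
    qed
    have bl: "is_path T (butlast r)" "hd (butlast r) = hd r"
      if r: "is_path T r" "3 \<le> length r" for r
    proof -
      obtain m z where "r = m @ [z]" "m \<noteq> []"
        using r(2) by (cases r rule: rev_cases) force+
      then show "is_path T (butlast r)" "hd (butlast r) = hd r"
        using r(1) is_path_appendD1[of T m "[z]"] by simp_all
    qed
    have tl: "is_path T (tl r)" "last (tl r) = last r"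
      if r: "is_path T r" "3 \<le> length r" for r
    proof -
      obtain a m where "r = a # m" "m \<noteq> []"
        using r(2) by (cases r) force+
      then show "is_path T (tl r)" "last (tl r) = last r"
        using r(1) is_path_appendD2[of T "[a]" m] by simp_all
    qed
    have bt: "is_path T (butlast (tl r))" "hd (butlast (tl r)) = hd (tl r)"
      "last (butlast (tl r)) = last (butlast r)"
      if r: "is_path T r" "3 \<le> length r" for r
    proof -
      obtain a m z where m: "r = a # m @ [z]" "m \<noteq> []"
        using r(2) by (cases r; cases "tl r" rule: rev_cases) force+
      then show "is_path T (butlast (tl r))" "hd (butlast (tl r)) = hd (tl r)"
        "last (butlast (tl r)) = last (butlast r)"
        using r is_path_appendD1[of T m "[z]"] is_path_appendD2[of T "[a]" "m @ [z]"]
        by (auto simp: butlast_append)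
    qed
    \<comment> \<open>These are the three ways of repairing a mismatch: at the end, at the start, or
      at both.\<close>
    have no: "butlast p \<noteq> q" "tl p \<noteq> q" "butlast (tl p) \<noteq> q"
      using q(2) len by auto
    note eqI = tree_path_eqI[OF T _ q(1)]
    show ?thesis
      using hds lasts no bl[OF p(1) len(1)] tl[OF p(1) len(1)] bt[OF p(1) len(1)]
        eqI[of "butlast p"] eqI[of "tl p"] eqI[of "butlast (tl p)"]
      by metis
  qed
qed

text \<open>Equal pairs of ends force \<open>p = q\<close> or \<open>p = rev q\<close>, and reversal
  preserves the extremal edges. Conversely, equal pairs of extremal edges match directly or
  crosswise, and the crossed case is the direct one for \<open>rev q\<close>.\<close>

lemma tree_path_kernel:
  assumes T: "is_tree T" and p: "is_path T p" "length p = k + 2"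
    and q: "is_path T q" "length q = k + 2"
  shows "{hd p, last p} = {hd q, last q} \<longleftrightarrow> end_edges p = end_edges q"
proof
  have ne: "p \<noteq> []" "q \<noteq> []"
    using p q by auto
  {
    assume "{hd p, last p} = {hd q, last q}"
    then have "p = q \<or> p = rev q"
      using tree_path_eqI[OF T p(1) q(1)] tree_path_eqI[OF T p(1), of "rev q"] q(1) ne
      by (auto simp: doubleton_eq_iff is_path_rev hd_rev last_rev)
    then show "end_edges p = end_edges q"
      by (auto simp: end_edges_def)
  next
    assume "end_edges p = end_edges q"
    then consider "first_edge p = first_edge q" "first_edge (rev p) = first_edge (rev q)"
      | "first_edge p = first_edge (rev q)" "first_edge (rev p) = first_edge (rev (rev q))"
      by (auto simp: end_edges_def doubleton_eq_iff)
    then show "{hd p, last p} = {hd q, last q}"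
    proof cases
      case 1
      then show ?thesis
        using tree_path_ends_eq_of_edges_eq[OF T p(1) _ q(1)] p q by simp
    next
      case 2
      then have "{hd p, last p} = {hd (rev q), last (rev q)}"
        using tree_path_ends_eq_of_edges_eq[OF T p(1), of "rev q"] p q by (simp add: is_path_rev)
      then show ?thesis
        using ne by (simp add: hd_rev last_rev insert_commute)
    qed
  }
qed

section \<open>Comparison of the two counts and of the polynomials\<close>

lemma tree_num_dist_Suc:
  assumes T: "is_tree T"
  shows "num_dist T (Suc k) = num_edge_dist T k"
proof -
  \<comment> \<open>Paths with \<open>k + 1\<close> edges: both counted families turn out to be
    images of this set, under the map to the ends and under \<open>end_edges\<close>.\<close>
  define S where "S = {p. is_path T p \<and> length p = k + 2}"
  have V: "{{u, v} | u v. u \<in> verts T \<and> v \<in> verts T \<and> graph_dist T u v = enat (Suc k)}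
      = (\<lambda>p. {hd p, last p}) ` S" (is "?A = ?B")
  proof (intro equalityI subsetI)
    fix P assume "P \<in> ?A"
    then obtain u v where uv: "P = {u, v}" "u \<in> verts T" "v \<in> verts T"
      "graph_dist T u v = enat (Suc k)"
      by blast
    obtain p where p: "path_between T u p v"
      using tree_path_exists[OF T uv(2,3)] .
    then have "length p - 1 = Suc k"
      using tree_graph_dist[OF T p] uv by simp
    then have "p \<in> S"
      using p by (auto simp: S_def path_between_def)
    then show "P \<in> ?B"
      using p uv by (auto simp: path_between_def)
  next
    fix P assume "P \<in> ?B"
    then obtain p where p: "P = {hd p, last p}" "is_path T p" "length p = k + 2"
      by (auto simp: S_def)
    then have "graph_dist T (hd p) (last p) = enat (Suc k)"
      using tree_graph_dist[OF T, of "hd p" p "last p"] by (simp add: path_between_def)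
    moreover have "hd p \<in> verts T" "last p \<in> verts T"
      using p(2) hd_in_set last_in_set by (auto simp: is_path_def)
    ultimately show "P \<in> ?A"
      using p by blast
  qed
  have E: "{{e, f} | e f. e \<in> edges T \<and> f \<in> edges T \<and> edge_dist T e f = enat k}
      = end_edges ` S" (is "?A = ?B")
  proof (intro equalityI subsetI)
    fix P assume "P \<in> ?A"
    then obtain e f where ef: "P = {e, f}" "e \<in> edges T" "f \<in> edges T" "edge_dist T e f = enat k"
      by blast
    obtain p where p: "is_path T p" "2 \<le> length p" "first_edge p = e" "first_edge (rev p) = f"
      using tree_path_through_edges[OF T ef(2,3)] .
    \<comment> \<open>The bound \<open>2 \<le> length p\<close> makes the truncated subtraction
      exact, so the distance determines the length of \<open>p\<close>.\<close>
    then have "edge_dist T e f = enat (length p - 2)"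
      using tree_edge_dist[OF T p(1), of "length p - 2"] by simp
    then have "p \<in> S"
      using p ef by (auto simp: S_def)
    then show "P \<in> ?B"
      using p ef by (auto simp: end_edges_def)
  next
    fix P assume "P \<in> ?B"
    then obtain p where p: "P = end_edges p" "is_path T p" "length p = k + 2"
      by (auto simp: S_def)
    have first: "first_edge r \<in> edges T" if "is_path T r" "length r = k + 2" for r
      using that by (cases r; cases "tl r") (auto simp: first_edge_def is_path_def)
    have "first_edge p \<in> edges T" "first_edge (rev p) \<in> edges T"
      using first[of p] first[of "rev p"] p by (simp_all add: is_path_rev)
    then show "P \<in> ?A"
      using p tree_edge_dist[OF T p(2,3)] unfolding end_edges_def by blast
  qed
  show ?thesis
    unfolding num_dist_def num_edge_dist_def V E
    by (rule card_image_eq_of_same_kernel, rule tree_path_kernel[OF T, of _ k]) (simp_all add: S_def)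
qed

lemma simple_graph_finite_edges:
  assumes "simple_graph G"
  shows "finite (edges G)"
  by (rule finite_subset[of _ "Pow (verts G)"]) (use assms in \<open>auto simp: simple_graph_def\<close>)

text \<open>Here \<open>monom 1 1\<close> is the variable x. Division by x takes place in the
  fraction field of \<open>int poly\<close>, into which \<open>to_fract\<close> embeds the
  polynomials.\<close>

theorem theorem2:
  fixes T :: "'a sgraph"
  assumes "is_tree T"
  shows "to_fract (edge_hosoya T) =
           1 / to_fract (monom 1 1) * to_fract (hosoya T)
             - of_nat (card (verts T)) / to_fract (monom 1 1)
       \<and> hosoya T = monom 1 1 * edge_hosoya T + of_nat (card (verts T))"
proof -
  have simple: "simple_graph T"
    using assms by (simp add: is_tree_def)
  have finV: "finite (verts T)" and finE: "finite (verts (line_graph T))"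
    using simple simple_graph_finite_edges[OF simple]
    by (simp_all add: simple_graph_def line_graph_def)
  have poly_eq: "hosoya T = monom 1 1 * edge_hosoya T + of_nat (card (verts T))"
  proof (rule poly_eqI)
    fix k
    show "coeff (hosoya T) k = coeff (monom 1 1 * edge_hosoya T + of_nat (card (verts T))) k"
      \<comment> \<open>Multiplication by x shifts the coefficients by one: the constant term counts
        the vertices, and the coefficient at \<open>Suc k\<close> is the comparison of the two
        counts.\<close>
      by (cases k) (simp_all add: coeff_hosoya finV finE num_dist_0 edge_hosoya_line_graph
          coeff_monom_mult tree_num_dist_Suc[OF assms] num_edge_dist_line_graph of_nat_poly)
  qed
  have of_nat: "to_fract (of_nat n :: int poly) = of_nat n" for n
    by (induction n) simp_all
  have "to_fract (monom 1 1 :: int poly) \<noteq> 0"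
    by (simp add: monom_eq_0_iff)
  \<comment> \<open>The polynomial identity is carried into the fraction field and divided by the
    nonzero element x.\<close>
  then have "to_fract (edge_hosoya T) =
      1 / to_fract (monom 1 1) * to_fract (hosoya T)
        - of_nat (card (verts T)) / to_fract (monom 1 1)"
    by (simp add: poly_eq of_nat field_simps)
  with poly_eq show ?thesis
    by blast
qed

end
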